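(* Let each $f_i:\mathbb{R}^p\to\mathbb{R}$ ($i=1,\dots,n$) be convex, coercive and differentiable with $L_{f_i}$-Lipschitz gradient ($L_{f_i}>0$), let $L_f=\max_i L_{f_i}$, and let $W$ be a mixing matrix (see context) with $\lambda_n(W)>0$. Let $0<\epsilon\le1$ and $\alpha_k=\frac{1}{L_f(k+1)^\epsilon}$, let ${\bf x}^0\in\mathbb{R}^{n\times p}$ be arbitrary, and let ${\bf x}^{k+1}=W{\bf x}^k-\alpha_k\nabla{\bf f}({\bf x}^k)$ for $k=0,1,\dots$. Suppose there is a constant $B>0$ with $\|\nabla{\bf f}({\bf x}^k)\|\le B$ for all $k$. Let $\bar f({\bf x})=\sum_{i=1}^nf_i({\bf x}_{(i)})$, $\bar{\bf x}^k=\frac1n{\bf 1}{\bf 1}^T{\bf x}^k$, let $f_{\mathrm{opt}}=\min_{x\in\mathbb{R}^p}\sum_{i=1}^nf_i(x)$, and define $$\bar f^K=\frac{\sum_{k=0}^K\alpha_k\bar f(\bar{\bf x}^{k+1})}{\sum_{k=0}^K\alpha_k}.$$ Then $\{\bar f^K\}$ converges to $f_{\mathrm{opt}}$ at the following rates (for $\bar f^K-f_{\mathrm{opt}}$ as $K\to\infty$): (a) if $0<\epsilon<1/2$, the rate is $\mathcal{O}(\frac{1}{K^\epsilon})$; (b) if $\epsilon=1/2$, the rate is $\mathcal{O}(\frac{\ln K}{\sqrt K})$; (c) if $1/2<\epsilon<1$, the rate is $\mathcal{O}(\frac{1}{K^{1-\epsilon}})$; (d) if $\epsilon=1$, the rate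 is $\mathcal{O}(\frac{1}{\ln K})$.
   Context: Notation. $\mathcal{G}=(\mathcal{V},\mathcal{E})$ is a connected undirected graph with $\mathcal{V}=\{1,\dots,n\}$. For ${\bf x}\in\mathbb{R}^{n\times p}$, ${\bf x}_{(i)}\in\mathbb{R}^p$ is its $i$-th row (as a column vector). $\|\cdot\|$ is the Frobenius norm, $I$ the $n\times n$ identity, ${\bf 1}\in\mathbb{R}^n$ the all-ones vector, and $\nabla{\bf f}({\bf x})\in\mathbb{R}^{n\times p}$ is the matrix whose $i$-th row is $\nabla f_i({\bf x}_{(i)})^T$. A function $h$ is coercive if $\|u\|\to\infty$ implies $h(u)\to+\infty$. Mixing matrix: $W=[w_{ij}]\in\mathbb{R}^{n\times n}$ such that (1) $w_{ij}=0$ if $i\ne j$ and $(i,j)\notin\mathcal{E}$, and $w_{ij}>0$ otherwise; (2) $W=W^T$; (3) $\mathrm{null}(I-W)=\mathrm{span}\{{\bf 1}\}$; (4) $I\succeq W\succ -I$. Its eigenvalues are $1=\lambda_1(W)>\lambda_2(W)\ge\dots\ge\lambda_n(W)>-1$. *)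

theory Defs
  imports "HOL-Analysis.Analysis" "HOL-Library.Landau_Symbols"
begin

text \<open>
  The vertex set \<open>{1, ..., n}\<close> is the finite type \<open>'n\<close>, and
  an \<open>n \<times> p\<close> matrix \<open>x\<close> is an element of \<open>real^'p^'n\<close>, so that \<open>x $ i\<close> is its
  \<open>i\<close>-th row and \<open>norm x\<close> is its Frobenius norm.
\<close>

definition connected_undirected_graph :: "('n \<times> 'n) set \<Rightarrow> bool" where
  "connected_undirected_graph E \<longleftrightarrow> sym E \<and> (\<forall>i j. (i, j) \<in> E\<^sup>*)"

definition pos_semidef :: "real^'n^'n \<Rightarrow> bool" where
  "pos_semidef A \<longleftrightarrow> transpose A = A \<and> (\<forall>v. 0 \<le> v \<bullet> (A *v v))"

definition pos_def :: "real^'n^'n \<Rightarrow> bool" where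
  "pos_def A \<longleftrightarrow> transpose A = A \<and> (\<forall>v. v \<noteq> 0 \<longrightarrow> 0 < v \<bullet> (A *v v))"

definition eigenvalue :: "real^'n^'n \<Rightarrow> real \<Rightarrow> bool" where
  "eigenvalue A l \<longleftrightarrow> (\<exists>v. v \<noteq> 0 \<and> A *v v = l *\<^sub>R v)"

text \<open>
  The smallest eigenvalue \<open>\<lambda>\<^sub>n\<close>. It is only used for symmetric matrices, whose
  spectrum is real, finite and nonempty.
\<close>

definition lambda_min :: "real^'n^'n \<Rightarrow> real" where
  "lambda_min A = Min {l. eigenvalue A l}"

text \<open>
  The diagonal of a mixing matrix is positive. In the third clause, \<open>1 :: real^'n\<close> is the
  all-ones vector, whereas the identity matrix is \<open>mat 1\<close>.
\<close>

definition mixing_matrix :: "('n \<times> 'n) set \<Rightarrow> real^'n^'n \<Rightarrow> bool" where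
  "mixing_matrix E W \<longleftrightarrow>
     (\<forall>i j. if i \<noteq> j \<and> (i, j) \<notin> E then W $ i $ j = 0 else W $ i $ j > 0) \<and>
     W = transpose W \<and>
     {v. (mat 1 - W) *v v = 0} = span {1 :: real^'n} \<and>
     pos_semidef (mat 1 - W) \<and> pos_def (W - (- mat 1))"

definition gradient :: "('a::real_inner \<Rightarrow> real) \<Rightarrow> 'a \<Rightarrow> 'a" where
  "gradient h u = (THE D. GDERIV h u :> D)"

definition stacked_gradient ::
    "('n \<Rightarrow> real^'p \<Rightarrow> real) \<Rightarrow> real^'p^'n \<Rightarrow> real^'p^'n" where
  "stacked_gradient f x = (\<chi> i. gradient (f i) (x $ i))"

definition fbar :: "('n::finite \<Rightarrow> real^'p \<Rightarrow> real) \<Rightarrow> real^'p^'n \<Rightarrow> real" where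
  "fbar f x = (\<Sum>i\<in>UNIV. f i (x $ i))"

text \<open>\<open>(1/n) 1 1\<^sup>T x\<close>: every row is the average of the rows of \<open>x\<close>.\<close>

definition xbar :: "real^'p^'n \<Rightarrow> real^'p^'n" where
  "xbar x = (1 / real CARD('n)) *\<^sub>R (((\<chi> i j. 1) :: real^'n^'n) ** x)"

text \<open>
  The minimum of \<open>h\<close> as a value attained at a minimizer; meaningful only if one exists,
  which is the case for continuous coercive \<open>h\<close>.
\<close>

definition min_value :: "('a \<Rightarrow> real) \<Rightarrow> real" where
  "min_value h = h (ARG_MIN h u. True)"

end

theory Submission
  imports Defs "HOL-Real_Asymp.Real_Asymp"
begin

text \<open>
  Split the iterate into the mean of its rows and the remaining disagreement between the rows.
  The matrix \<open>W\<close> fixes the mean and, having its spectrum in \<open>(-1, 1]\<close> with \<open>1\<close> as a simple eigenvalue,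
  contracts the disagreement by a fixed factor below one (\<open>contraction_modulus\<close>). Since the
  gradients stay bounded, the step at time \<open>k\<close> adds at most a multiple of \<open>\<alpha> k\<close> to the
  disagreement. Hence the disagreements, weighted by the step sizes, add up to at most
  \<open>C + D * (\<Sum>k\<le>K. (\<alpha> k)\<^sup>2)\<close> (\<open>consensus\<close>).

  The mean follows a gradient step for the total objective, in which the local gradients are
  taken at the rows. Convexity therefore gives the estimate known from subgradient methods: the
  suboptimality of the new mean, times the step size, is bounded by the decrease of the squared
  distance to a minimizer, plus errors proportional to \<open>\<alpha> k\<close> times the disagreement and to
  \<open>(\<alpha> k)\<^sup>2\<close> (\<open>progress\<close>). After summation the distances telescope, and dividing by
  the sum of the step sizes yields
  \<open>0 \<le> F K - f_opt \<le> (C + D * (\<Sum>k\<le>K. (\<alpha> k)\<^sup>2)) / (\<Sum>k\<le>K. \<alpha> k)\<close>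
  (\<open>weighted_suboptimality\<close>). The rates are the growth of these two sums for \<open>\<alpha> k\<close>
  proportional to \<open>1 / (k + 1) powr \<epsilon>\<close> (\<open>averaging_rates\<close>).
\<close>

section \<open>Gradients, convexity and minimizers\<close>

text \<open>In finite dimension every derivative is the inner product with a unique vector.\<close>

lemma GDERIV_gradient:
  fixes h :: "'a::euclidean_space \<Rightarrow> real"
  assumes "h differentiable (at u)"
  shows "GDERIV h u :> gradient h u"
proof -
  obtain h' where h': "(h has_derivative h') (at u)"
    using assms by (auto simp: differentiable_def)
  define D where "D = (\<Sum>b\<in>Basis. h' b *\<^sub>R b)"
  have "h' v = v \<bullet> D" for v
  proof -
    have "linear h'" using h' has_derivative_linear by blast
    then have "h' v = (\<Sum>b\<in>Basis. (v \<bullet> b) * h' b)"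
      using Linear_Algebra.linear_componentwise[of h' v 1] by simp
    also have "\<dots> = v \<bullet> D" by (simp add: D_def inner_sum_right mult.commute)
    finally show ?thesis .
  qed
  then have "h' = (\<lambda>v. v \<bullet> D)" by auto
  with h' have D: "GDERIV h u :> D" by (simp add: gderiv_def)
  have "D' = D" if "GDERIV h u :> D'" for D'
  proof -
    have "(\<lambda>v. v \<bullet> D') = (\<lambda>v. v \<bullet> D)"
      using that D unfolding gderiv_def by (rule has_derivative_unique)
    then have "(D' - D) \<bullet> D' = (D' - D) \<bullet> D" by metis
    then have "(D' - D) \<bullet> (D' - D) = 0" by (simp add: inner_diff_right)
    then show ?thesis by simp
  qed
  with D show ?thesis unfolding gradient_def by (metis theI)
qed

text \<open>
  Restricted to the line through \<open>u\<close> and \<open>v\<close>, the function is convex in one real variable, so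
  its graph lies above the tangent at the parameter \<open>0\<close>, whose slope is the directional derivative.
\<close>

lemma convex_on_above_gradient:
  fixes h :: "'a::euclidean_space \<Rightarrow> real"
  assumes "convex_on UNIV h" "h differentiable (at u)"
  shows "h u + gradient h u \<bullet> (v - u) \<le> h v"
proof -
  let ?\<phi> = "\<lambda>t. h (u + t *\<^sub>R (v - u))"
  have "convex_on UNIV ?\<phi>"
  proof (rule convex_onI)
    fix t a b :: real assume t: "0 < t" "t < 1"
    have "u + ((1 - t) *\<^sub>R a + t *\<^sub>R b) *\<^sub>R (v - u) =
        (1 - t) *\<^sub>R (u + a *\<^sub>R (v - u)) + t *\<^sub>R (u + b *\<^sub>R (v - u))"
      by (simp add: algebra_simps)
    then show "?\<phi> ((1 - t) *\<^sub>R a + t *\<^sub>R b) \<le> (1 - t) * ?\<phi> a + t * ?\<phi> b"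
      using convex_onD[OF assms(1), of t "u + a *\<^sub>R (v - u)" "u + b *\<^sub>R (v - u)"] t
      by simp
  qed simp
  moreover have "(?\<phi> has_real_derivative gradient h u \<bullet> (v - u)) (at 0)"
  proof -
    have "(h has_derivative (\<lambda>w. w \<bullet> gradient h u)) (at (u + 0 *\<^sub>R (v - u)))"
      using GDERIV_gradient[OF assms(2)] by (simp add: gderiv_def)
    then have "(?\<phi> has_derivative (\<lambda>t. (t *\<^sub>R (v - u)) \<bullet> gradient h u)) (at 0)"
      by (rule has_derivative_compose[rotated]) (auto intro!: derivative_eq_intros)
    then show ?thesis
      by (simp add: has_field_derivative_def inner_commute mult.commute[of _ "gradient h u \<bullet> (v - u)"] )
  qed
  ultimately have "?\<phi> 1 - ?\<phi> 0 \<ge> gradient h u \<bullet> (v - u) * (1 - 0)"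
    by (intro convex_on_imp_above_tangent[of UNIV]) auto
  then show ?thesis by simp
qed

lemma coercive_sum:
  fixes f :: "'i \<Rightarrow> 'a::real_normed_vector \<Rightarrow> real"
  assumes "finite I" "I \<noteq> {}" "\<And>i. i \<in> I \<Longrightarrow> filterlim (f i) at_top at_infinity"
  shows "filterlim (\<lambda>u. \<Sum>i\<in>I. f i u) at_top at_infinity"
  using assms by (induction rule: finite_ne_induct) (auto intro: filterlim_at_top_add_at_top)

text \<open>
  Outside a large ball the function exceeds its value at the origin, so that a minimizer over
  the compact ball, which contains the origin, is a global one.
\<close>

lemma coercive_attains_min:
  fixes h :: "'a::euclidean_space \<Rightarrow> real"
  assumes "continuous_on UNIV h" "filterlim h at_top at_infinity"
  shows "\<exists>u. \<forall>v. h u \<le> h v"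
proof -
  have "eventually (\<lambda>v. h 0 \<le> h v) at_infinity"
    using assms(2) by (simp add: filterlim_at_top)
  then obtain r where r: "\<And>v. r \<le> norm v \<Longrightarrow> h 0 \<le> h v"
    by (auto simp: eventually_at_infinity)
  have "\<exists>u\<in>cball 0 \<bar>r\<bar>. \<forall>v\<in>cball 0 \<bar>r\<bar>. h u \<le> h v"
    by (rule continuous_attains_inf) (use assms(1) continuous_on_subset in auto)
  then obtain u where u: "\<And>v. norm v \<le> \<bar>r\<bar> \<Longrightarrow> h u \<le> h v"
    by (metis mem_cball_0)
  have "h u \<le> h v" for v
    using u[of v] u[of 0] r[of v] by (cases "norm v \<le> \<bar>r\<bar>") force+
  then show ?thesis by blast
qed

lemma min_value_attained:
  assumes "\<exists>u. \<forall>v. h u \<le> (h v :: real)"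
  obtains u where "h u = min_value h" "\<And>v. min_value h \<le> h v"
proof -
  obtain u0 where u0: "\<And>v. h u0 \<le> h v" using assms by blast
  have "is_arg_min h (\<lambda>_. True) (ARG_MIN h u. True)"
    unfolding arg_min_def by (rule someI[of _ u0]) (use u0 in \<open>auto simp: is_arg_min_def not_less\<close>)
  then show ?thesis
    using that[of "ARG_MIN h u. True"] by (auto simp: is_arg_min_def min_value_def not_less)
qed

section \<open>Mixing as a contraction of the disagreement\<close>

lemma symmetric_inner_commute:
  fixes A :: "real^'n^'n"
  assumes "transpose A = A"
  shows "(A *v v) \<bullet> w = v \<bullet> (A *v w)"
  using dot_lmul_matrix[of v A w] transpose_matrix_vector[of A v] assms by simp

text \<open>
  The hypotheses say \<open>-I \<prec> W \<preceq> I\<close>. The claim is that \<open>I - W\<^sup>2\<close> is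
  positive at \<open>v\<close>. With \<open>P = I - W\<close> and \<open>Q = I + W\<close>, which commute and add up to \<open>2 I\<close>,
  one has \<open>2 (I - W\<^sup>2) = P Q (P + Q) = P Q P + Q P Q\<close>. Both summands are positive semidefinite,
  and the first one is strictly positive at \<open>v\<close> because \<open>P v \<noteq> 0\<close> and \<open>Q\<close> is positive definite.
\<close>

lemma norm_symmetric_mult_less:
  fixes W :: "real^'n^'n"
  assumes sym: "transpose W = W" and le: "\<And>v. v \<bullet> (W *v v) \<le> v \<bullet> v"
    and gr: "\<And>v. v \<noteq> 0 \<Longrightarrow> - (v \<bullet> v) < v \<bullet> (W *v v)" and v: "W *v v \<noteq> v"
  shows "norm (W *v v) < norm v"
proof -
  define p where "p = v - W *v v"
  define q where "q = v + W *v v"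
  have W2: "(W *v (W *v v)) \<bullet> w = (W *v v) \<bullet> (W *v w)" "(W *v v) \<bullet> w = v \<bullet> (W *v w)" for w
    by (simp_all add: symmetric_inner_commute[OF sym])
  have "2 * (v \<bullet> v - (W *v v) \<bullet> (W *v v)) = (p \<bullet> p + p \<bullet> (W *v p)) + (q \<bullet> q - q \<bullet> (W *v q))"
    using W2(2)[of v] W2(2)[of "W *v v"]
    by (simp add: p_def q_def algebra_simps inner_commute)
  moreover have "0 < p \<bullet> p + p \<bullet> (W *v p)" using gr[of p] v by (simp add: p_def)
  moreover have "0 \<le> q \<bullet> q - q \<bullet> (W *v q)" using le[of q] by simp
  ultimately show ?thesis by (simp add: norm_lt)
qed

definition row_mean :: "'a::real_vector^'n \<Rightarrow> 'a" where
  "row_mean x = (\<Sum>i\<in>UNIV. x $ i) /\<^sub>R real CARD('n)"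

lemma xbar_nth: "xbar x $ i = row_mean x"
  by (simp add: xbar_def row_mean_def matrix_matrix_mult_def vec_eq_iff divide_inverse)

lemma sum_rows: "(\<Sum>i\<in>UNIV. x $ i) = real CARD('n) *\<^sub>R row_mean (x :: 'a::real_vector^'n)"
  by (simp add: row_mean_def)

text \<open>The orthogonal projection onto the matrices whose columns are orthogonal to the all-ones vector.\<close>

definition disagreement :: "real^'p^'n \<Rightarrow> real^'p^'n" where
  "disagreement x = x - xbar x"

lemma disagreement_nth: "disagreement x $ i = x $ i - row_mean x"
  by (simp add: disagreement_def xbar_nth)

lemma sum_rows_disagreement: "(\<Sum>i\<in>UNIV. disagreement x $ i) = 0"
  for x :: "real^'p^'n"
  by (simp add: disagreement_nth sum_subtractf sum_rows scaleR_conv_of_real sum_constant_scaleR)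

lemma norm_disagreement_le: "norm (disagreement x) \<le> norm x"
proof -
  have "disagreement x \<bullet> xbar x = (\<Sum>i\<in>UNIV. disagreement x $ i) \<bullet> row_mean x"
    by (simp add: inner_vec_def[of _ "xbar x"] xbar_nth inner_sum_left)
  then have "orthogonal (disagreement x) (xbar x)"
    by (simp add: sum_rows_disagreement orthogonal_def)
  then have "(norm (disagreement x + xbar x))\<^sup>2 = (norm (disagreement x))\<^sup>2 + (norm (xbar x))\<^sup>2"
    by (rule norm_add_Pythagorean)
  then have "(norm (disagreement x))\<^sup>2 \<le> (norm x)\<^sup>2" by (simp add: disagreement_def)
  then show ?thesis by simp
qed

text \<open>
  Multiplication by \<open>W\<close> acts on each column separately, so facts about \<open>W\<close> on vectors carry over
  to matrices through this column-wise form of the Frobenius norm.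
\<close>

lemma norm_rows_columns:
  "(norm (x :: real^'p^'n))\<^sup>2 = (\<Sum>j\<in>UNIV. (norm (column j x))\<^sup>2)"
proof -
  have "(norm x)\<^sup>2 = (\<Sum>i\<in>UNIV. \<Sum>j\<in>UNIV. x $ i $ j * x $ i $ j)"
    by (simp add: power2_norm_eq_inner inner_vec_def)
  also have "\<dots> = (\<Sum>j\<in>UNIV. \<Sum>i\<in>UNIV. x $ i $ j * x $ i $ j)"
    by (rule sum.swap)
  also have "\<dots> = (\<Sum>j\<in>UNIV. (norm (column j x))\<^sup>2)"
    by (simp add: power2_norm_eq_inner inner_vec_def column_def)
  finally show ?thesis .
qed

lemma column_matrix_mult: "column j (A ** x) = A *v column j x"
  by (simp add: column_def matrix_matrix_mult_def matrix_vector_mult_def vec_eq_iff)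

text \<open>
  The spectral content of a mixing matrix: the spectrum lies in
  \<open>(-1, 1]\<close>, and the eigenspace of \<open>1\<close> consists of the constant vectors.
\<close>

locale averaging_matrix =
  fixes W :: "real^'n::finite^'n"
  assumes symmetric: "transpose W = W"
    and le_1: "\<And>v. v \<bullet> (W *v v) \<le> v \<bullet> v"
    and greater_minus_1: "\<And>v. v \<noteq> 0 \<Longrightarrow> - (v \<bullet> v) < v \<bullet> (W *v v)"
    and fixed_iff: "\<And>v. W *v v = v \<longleftrightarrow> v \<in> span {1}"
begin

lemma row_sum: "(\<Sum>j\<in>UNIV. W $ i $ j) = 1"
proof -
  have "W *v 1 = 1" by (simp add: fixed_iff span_base)
  then have "(W *v 1) $ i = 1" by simp
  then show ?thesis by (simp add: matrix_vector_mult_def)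
qed

lemma column_sum: "(\<Sum>i\<in>UNIV. W $ i $ j) = 1"
proof -
  have "W $ i $ j = W $ j $ i" for i using symmetric by (metis transpose_def vec_lambda_beta)
  then show ?thesis by (simp add: row_sum)
qed

lemma mult_nth: "(W ** x) $ i = (\<Sum>j\<in>UNIV. W $ i $ j *\<^sub>R x $ j)"
  by (simp add: matrix_matrix_mult_def vec_eq_iff)

lemma row_mean_mult: "row_mean (W ** x) = row_mean x"
proof -
  have "(\<Sum>i\<in>UNIV. (W ** x) $ i) = (\<Sum>j\<in>UNIV. \<Sum>i\<in>UNIV. W $ i $ j *\<^sub>R x $ j)"
    unfolding mult_nth by (rule sum.swap)
  also have "\<dots> = (\<Sum>j\<in>UNIV. x $ j)"
    by (simp add: scaleR_sum_left[symmetric] column_sum)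
  finally show ?thesis by (simp add: row_mean_def)
qed

lemma disagreement_mult: "disagreement (W ** x) = W ** disagreement x"
proof -
  have "(\<Sum>j\<in>UNIV. W $ i $ j *\<^sub>R disagreement x $ j) = (W ** x) $ i - row_mean x" for i
    by (simp add: disagreement_nth mult_nth scaleR_diff_right sum_subtractf
        scaleR_sum_left[symmetric] row_sum)
  then show ?thesis
    by (simp add: vec_eq_iff[of "disagreement _"] disagreement_nth row_mean_mult
        mult_nth[of "disagreement x"])
qed

lemma norm_mult_less:
  fixes y :: "real^'p^'n"
  assumes "(\<Sum>i\<in>UNIV. y $ i) = 0" "y \<noteq> 0"
  shows "norm (W ** y) < norm y"
proof -
  have less: "norm (W *v v) < norm v" if "(\<Sum>i\<in>UNIV. v $ i) = 0" "v \<noteq> 0" for v :: "real^'n"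
  proof (rule norm_symmetric_mult_less)
    show "W *v v \<noteq> v"
    proof
      assume "W *v v = v"
      then obtain c where "v = c *\<^sub>R 1" by (auto simp: fixed_iff span_singleton)
      then show False using that by simp
    qed
  qed (use symmetric le_1 greater_minus_1 in auto)
  have col: "(\<Sum>i\<in>UNIV. column j y $ i) = 0" for j
  proof -
    have "(\<Sum>i\<in>UNIV. y $ i) $ j = 0" using assms(1) by simp
    then show ?thesis by (simp add: column_def)
  qed
  have "\<exists>j. column j y \<noteq> 0"
    using assms(2) by (auto simp: vec_eq_iff column_def)
  then obtain j where "column j y \<noteq> 0" by blast
  then have "(\<Sum>j\<in>UNIV. (norm (W *v column j y))\<^sup>2) < (\<Sum>j\<in>UNIV. (norm (column j y))\<^sup>2)"
  proof (intro sum_strict_mono_ex1 ballI bexI[of _ j])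
    show "(norm (W *v column j y))\<^sup>2 \<le> (norm (column j y))\<^sup>2" for j
      using less[OF col, of j] by (cases "column j y = 0") auto
  qed (use less[OF col, of j] in \<open>auto intro!: power_strict_mono\<close>)
  then have "(norm (W ** y))\<^sup>2 < (norm y)\<^sup>2"
    by (simp add: norm_rows_columns column_matrix_mult)
  then show ?thesis by (rule power_less_imp_less_base) simp
qed

text \<open>
  Compactness of the unit sphere turns the pointwise strict inequality into a uniform factor.
\<close>

lemma contraction_modulus:
  obtains \<rho> where "0 \<le> \<rho>" "\<rho> < 1"
    "\<And>y :: real^'p^'n. (\<Sum>i\<in>UNIV. y $ i) = 0 \<Longrightarrow> norm (W ** y) \<le> \<rho> * norm y"
proof -
  let ?S = "sphere 0 1 \<inter> {y :: real^'p^'n. (\<Sum>i\<in>UNIV. y $ i) = 0}"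
  have "compact ?S"
    by (intro compact_Int_closed closed_Collect_eq continuous_intros) auto
  moreover have cont: "continuous_on ?S (\<lambda>y. norm (W ** y))"
    unfolding matrix_matrix_mult_def by (intro continuous_intros)
  ultimately have "\<exists>\<rho>. 0 \<le> \<rho> \<and> \<rho> < 1 \<and> (\<forall>y\<in>?S. norm (W ** y) \<le> \<rho>)"
  proof (cases "?S = {}")
    case False
    then obtain y where y: "y \<in> ?S" "\<forall>w\<in>?S. norm (W ** w) \<le> norm (W ** y)"
      using continuous_attains_sup[OF \<open>compact ?S\<close> _ cont] by blast
    then have "norm (W ** y) < 1" using norm_mult_less[of y] by fastforce
    with y(2) show ?thesis by (intro exI[of _ "norm (W ** y)"]) auto
  qed (auto intro!: exI[of _ 0])
  then obtain \<rho> where \<rho>: "0 \<le> \<rho>" "\<rho> < 1" "\<And>y. y \<in> ?S \<Longrightarrow> norm (W ** y) \<le> \<rho>" by blast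
  have "norm (W ** y) \<le> \<rho> * norm y" if y: "(\<Sum>i\<in>UNIV. y $ i) = 0" for y :: "real^'p^'n"
  proof (cases "y = 0")
    case False
    have "(\<Sum>i\<in>UNIV. (y /\<^sub>R norm y) $ i) = 0"
      using y by (simp add: scaleR_sum_right[symmetric])
    then have "norm (W ** (y /\<^sub>R norm y)) \<le> \<rho>" using False by (intro \<rho>(3)) simp
    moreover have "W ** (y /\<^sub>R norm y) = (W ** y) /\<^sub>R norm y"
      by (simp add: vec_eq_iff mult_nth sum_distrib_left mult_ac)
    ultimately show ?thesis using False by (simp add: field_simps)
  next
    case True
    then have "W ** y = 0" by (simp add: vec_eq_iff mult_nth)
    with True show ?thesis by simp
  qed
  with \<rho>(1,2) that show ?thesis by blast
qed

end

section \<open>Perturbed contractions of real sequences\<close>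

text \<open>
  Multiplying the recursion by \<open>\<alpha> k\<close> and replacing \<open>\<alpha> k\<close> on the left by the smaller
  \<open>\<alpha> (Suc k)\<close> turns it into a recursion for the products \<open>\<alpha> k * Y k\<close>, which can be summed.
\<close>

lemma contraction_weighted_sum:
  fixes Y \<alpha> :: "nat \<Rightarrow> real"
  assumes step: "\<And>k. Y (Suc k) \<le> \<rho> * Y k + \<alpha> k * B"
    and Y: "\<And>k. 0 \<le> Y k" and \<alpha>: "\<And>k. 0 \<le> \<alpha> k" "decseq \<alpha>" and \<rho>: "0 \<le> \<rho>"
    and B: "0 \<le> B"
  shows "(1 - \<rho>) * (\<Sum>k\<le>K. \<alpha> k * Y k) \<le> \<alpha> 0 * Y 0 + B * (\<Sum>k\<le>K. (\<alpha> k)\<^sup>2)"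
proof -
  \<comment> \<open>The boundary term is what makes the induction go through.\<close>
  have "(1 - \<rho>) * (\<Sum>k\<le>K. \<alpha> k * Y k) + \<rho> * (\<alpha> K * Y K) \<le> \<alpha> 0 * Y 0 + B * (\<Sum>k<K. (\<alpha> k)\<^sup>2)"
  proof (induction K)
    case (Suc K)
    have "\<alpha> (Suc K) * Y (Suc K) \<le> \<alpha> K * Y (Suc K)"
      using \<alpha>(2) Y by (intro mult_right_mono) (auto simp: decseq_SucD)
    also have "\<dots> \<le> \<alpha> K * (\<rho> * Y K + \<alpha> K * B)"
      using step \<alpha>(1) by (intro mult_left_mono)
    finally show ?case using Suc.IH by (simp add: algebra_simps power2_eq_square)
  qed (simp add: algebra_simps)
  moreover have "0 \<le> \<rho> * (\<alpha> K * Y K)" using \<rho> \<alpha> Y by simp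
  moreover have "B * (\<Sum>k<K. (\<alpha> k)\<^sup>2) \<le> B * (\<Sum>k\<le>K. (\<alpha> k)\<^sup>2)"
    using B by (intro mult_left_mono sum_mono2) auto
  ultimately show ?thesis by linarith
qed

lemma contraction_bounded:
  fixes Y \<alpha> :: "nat \<Rightarrow> real"
  assumes step: "\<And>k. Y (Suc k) \<le> \<rho> * Y k + \<alpha> k * B"
    and \<alpha>: "decseq \<alpha>" and \<rho>: "0 \<le> \<rho>" "\<rho> < 1" and B: "0 \<le> B"
  shows "Y k \<le> max (Y 0) (\<alpha> 0 * B / (1 - \<rho>))"
proof (induction k)
  case (Suc k)
  let ?M = "max (Y 0) (\<alpha> 0 * B / (1 - \<rho>))"
  have "\<alpha> k * B \<le> \<alpha> 0 * B"
    using \<alpha> B by (intro mult_right_mono) (auto simp: decseq_def)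
  also have "\<alpha> 0 * B = (1 - \<rho>) * (\<alpha> 0 * B / (1 - \<rho>))" using \<rho> by simp
  also have "\<dots> \<le> (1 - \<rho>) * ?M" using \<rho> by (intro mult_left_mono) auto
  finally have "\<rho> * Y k + \<alpha> k * B \<le> \<rho> * ?M + (1 - \<rho>) * ?M"
    using mult_left_mono[OF Suc.IH \<rho>(1)] by linarith
  with step[of k] show ?case by (simp add: algebra_simps)
qed simp

section \<open>Decentralized gradient descent with decreasing step sizes\<close>

locale decentralized_gradient_descent = averaging_matrix W for W :: "real^'n::finite^'n" +
  fixes f :: "'n \<Rightarrow> real^'p \<Rightarrow> real" and L B :: real
    and \<alpha> :: "nat \<Rightarrow> real" and x :: "nat \<Rightarrow> real^'p^'n"
  assumes convex: "\<And>i. convex_on UNIV (f i)"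
    and differentiable: "\<And>i u. f i differentiable (at u)"
    and lipschitz: "\<And>i. L-lipschitz_on UNIV (gradient (f i))"
    and \<alpha>_nonneg: "\<And>k. 0 \<le> \<alpha> k" and \<alpha>_decseq: "decseq \<alpha>"
    and iteration: "\<And>k. x (Suc k) = W ** x k - \<alpha> k *\<^sub>R stacked_gradient f (x k)"
    and gradient_bounded: "\<And>k. norm (stacked_gradient f (x k)) \<le> B"
begin

lemma B_nonneg: "0 \<le> B"
  using gradient_bounded[of 0] norm_ge_zero order_trans by blast

lemma norm_gradient_le: "norm (gradient (f i) (x k $ i)) \<le> B" for i k
  using Finite_Cartesian_Product.norm_nth_le[of "stacked_gradient f (x k)" i] gradient_bounded[of k]
  by (simp add: stacked_gradient_def)

text \<open>
  Mixing preserves the mean of the rows, so the mean performs an inexact gradient step: the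
  local gradients are evaluated at the rows instead of at the mean.
\<close>

lemma row_mean_step: "row_mean (x (Suc k)) =
  row_mean (x k) - (\<alpha> k / real CARD('n)) *\<^sub>R (\<Sum>i\<in>UNIV. gradient (f i) (x k $ i))"
proof -
  have "row_mean (x (Suc k)) = row_mean (W ** x k) - \<alpha> k *\<^sub>R row_mean (stacked_gradient f (x k))"
    by (simp add: iteration row_mean_def sum_subtractf scaleR_sum_right algebra_simps)
  then show ?thesis
    by (simp add: row_mean_mult) (simp add: row_mean_def stacked_gradient_def divide_inverse)
qed

lemma disagreement_step:
  "disagreement (x (Suc k)) = W ** disagreement (x k) - \<alpha> k *\<^sub>R disagreement (stacked_gradient f (x k))"
proof -
  have lin: "disagreement (y - c *\<^sub>R w) = disagreement y - c *\<^sub>R disagreement w"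
    for y w :: "real^'p^'n" and c
    by (simp add: vec_eq_iff disagreement_nth row_mean_def sum_subtractf scaleR_sum_right
        sum_distrib_left algebra_simps)
  show ?thesis by (simp add: iteration lin disagreement_mult)
qed

lemma consensus:
  obtains C D M where "0 \<le> C" "0 \<le> D" "\<And>k. norm (disagreement (x k)) \<le> M"
    "\<And>K. (\<Sum>k\<le>K. \<alpha> k * norm (disagreement (x k))) \<le> C + D * (\<Sum>k\<le>K. (\<alpha> k)\<^sup>2)"
proof -
  obtain \<rho> where \<rho>: "0 \<le> \<rho>" "\<rho> < 1"
    "\<And>y :: real^'p^'n. (\<Sum>i\<in>UNIV. y $ i) = 0 \<Longrightarrow> norm (W ** y) \<le> \<rho> * norm y"
    using contraction_modulus by blast
  let ?Y = "\<lambda>k. norm (disagreement (x k))"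
  have step: "?Y (Suc k) \<le> \<rho> * ?Y k + \<alpha> k * B" for k
  proof -
    have "?Y (Suc k) \<le> norm (W ** disagreement (x k))
        + norm (\<alpha> k *\<^sub>R disagreement (stacked_gradient f (x k)))"
      unfolding disagreement_step by (rule norm_triangle_ineq4)
    also have "\<dots> \<le> \<rho> * ?Y k + \<alpha> k * B"
    proof (rule add_mono)
      show "norm (W ** disagreement (x k)) \<le> \<rho> * ?Y k"
        by (rule \<rho>(3)) (rule sum_rows_disagreement)
      have "norm (disagreement (stacked_gradient f (x k))) \<le> B"
        using norm_disagreement_le gradient_bounded order_trans by blast
      then show "norm (\<alpha> k *\<^sub>R disagreement (stacked_gradient f (x k))) \<le> \<alpha> k * B"
        using \<alpha>_nonneg[of k] by (simp add: mult_left_mono)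
    qed
    finally show ?thesis .
  qed
  let ?C = "\<alpha> 0 * ?Y 0 / (1 - \<rho>)" and ?D = "B / (1 - \<rho>)"
  have "(\<Sum>k\<le>K. \<alpha> k * ?Y k) \<le> ?C + ?D * (\<Sum>k\<le>K. (\<alpha> k)\<^sup>2)" for K
  proof -
    have "(1 - \<rho>) * (\<Sum>k\<le>K. \<alpha> k * ?Y k) \<le> \<alpha> 0 * ?Y 0 + B * (\<Sum>k\<le>K. (\<alpha> k)\<^sup>2)"
      using step \<alpha>_nonneg \<alpha>_decseq \<rho>(1) B_nonneg
      by (intro contraction_weighted_sum) auto
    then have "(\<Sum>k\<le>K. \<alpha> k * ?Y k) \<le> (\<alpha> 0 * ?Y 0 + B * (\<Sum>k\<le>K. (\<alpha> k)\<^sup>2)) / (1 - \<rho>)"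
      using \<rho>(2) by (simp add: pos_le_divide_eq mult.commute)
    then show ?thesis by (simp add: add_divide_distrib)
  qed
  moreover have "?Y k \<le> max (?Y 0) (\<alpha> 0 * B / (1 - \<rho>))" for k
    by (rule contraction_bounded[where Y = ?Y, OF step \<alpha>_decseq \<rho>(1,2) B_nonneg])
  moreover have "0 \<le> ?C" "0 \<le> ?D" using \<rho>(2) \<alpha>_nonneg[of 0] B_nonneg by auto
  ultimately show ?thesis using that by blast
qed

text \<open>
  The standard expansion of the squared distance of the mean to a reference point \<open>u\<close>. Two tangent
  inequalities for each \<open>f i\<close> are combined: the one at the row \<open>x k $ i\<close> compares \<open>f i (x k $ i)\<close>
  with \<open>f i u\<close>, the one at the new mean compares the value there with \<open>f i (x k $ i)\<close>. The errors
  are the distance from the row to the old mean, which the disagreement bounds, and the distance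
  between the two means, which is at most \<open>\<alpha> k * B\<close>.
\<close>

lemma progress:
  assumes M: "\<And>i. norm (gradient (f i) (row_mean (x (Suc k)))) \<le> M"
  shows "2 * \<alpha> k / real CARD('n) *
      ((\<Sum>i\<in>UNIV. f i (row_mean (x (Suc k)))) - (\<Sum>i\<in>UNIV. f i u))
    \<le> (norm (row_mean (x k) - u))\<^sup>2 - (norm (row_mean (x (Suc k)) - u))\<^sup>2
      + 2 * (B + M) * (\<alpha> k * norm (disagreement (x k))) + (B\<^sup>2 + 2 * M * B) * (\<alpha> k)\<^sup>2"
proof -
  define n where "n = real CARD('n)"
  define z where "z = row_mean (x k)"
  define z' where "z' = row_mean (x (Suc k))"
  define G where "G = (\<Sum>i\<in>UNIV. gradient (f i) (x k $ i))"
  define Y where "Y = norm (disagreement (x k))"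
  have n: "n > 0" by (simp add: n_def)
  have z': "z' = z - (\<alpha> k / n) *\<^sub>R G"
    by (simp add: z'_def z_def G_def n_def row_mean_step)
  have "norm G \<le> (\<Sum>i\<in>(UNIV::'n set). B)"
    unfolding G_def by (intro sum_norm_le norm_gradient_le)
  then have "norm G \<le> n * B" by (simp add: n_def)
  then have "\<alpha> k / n * norm G \<le> \<alpha> k / n * (n * B)"
    using n \<alpha>_nonneg[of k] by (intro mult_left_mono) auto
  then have move: "norm ((\<alpha> k / n) *\<^sub>R G) \<le> \<alpha> k * B"
    using n \<alpha>_nonneg[of k] by simp
  have dev: "norm (x k $ i - z) \<le> Y" for i
    using Finite_Cartesian_Product.norm_nth_le[of "disagreement (x k)" i] by (simp add: disagreement_nth z_def Y_def)
  have "0 \<le> M" using M norm_ge_zero order_trans by blast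
  have term_le: "f i z' - f i u \<le> gradient (f i) (x k $ i) \<bullet> (z - u) + (B + M) * Y + M * (\<alpha> k * B)"
    for i
  proof -
    let ?g = "gradient (f i) (x k $ i)" and ?g' = "gradient (f i) z'"
    have "f i (x k $ i) + ?g \<bullet> (u - x k $ i) \<le> f i u"
      by (rule convex_on_above_gradient[OF convex differentiable])
    moreover have "f i z' + ?g' \<bullet> (x k $ i - z') \<le> f i (x k $ i)"
      by (rule convex_on_above_gradient[OF convex differentiable])
    moreover have "?g \<bullet> (x k $ i - z) \<le> B * Y"
      by (rule order_trans[OF norm_cauchy_schwarz])
        (intro mult_mono norm_gradient_le dev B_nonneg norm_ge_zero)
    moreover have "?g' \<bullet> (z' - x k $ i) \<le> M * (Y + \<alpha> k * B)"
    proof -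
      have "norm (z' - x k $ i) \<le> norm (x k $ i - z) + norm ((\<alpha> k / n) *\<^sub>R G)"
        using norm_triangle_ineq[of "x k $ i - z" "(\<alpha> k / n) *\<^sub>R G"]
        by (simp add: z' norm_minus_commute algebra_simps)
      then have "norm (z' - x k $ i) \<le> Y + \<alpha> k * B" using dev[of i] move by linarith
      then show ?thesis
        using M[of i] \<open>0 \<le> M\<close>
        by (intro order_trans[OF norm_cauchy_schwarz] mult_mono) (auto simp: z'_def)
    qed
    ultimately show ?thesis by (simp add: inner_diff_right algebra_simps)
  qed
  have "(\<Sum>i\<in>UNIV. f i z') - (\<Sum>i\<in>UNIV. f i u) = (\<Sum>i\<in>UNIV. f i z' - f i u)"
    by (simp add: sum_subtractf)
  also have "\<dots> \<le> (\<Sum>i\<in>UNIV. gradient (f i) (x k $ i) \<bullet> (z - u) + (B + M) * Y + M * (\<alpha> k * B))"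
    by (intro sum_mono term_le)
  also have "\<dots> = G \<bullet> (z - u) + n * ((B + M) * Y + M * (\<alpha> k * B))"
    by (simp add: sum.distrib G_def inner_sum_left n_def distrib_left mult.assoc)
  finally have "2 * \<alpha> k / n * ((\<Sum>i\<in>UNIV. f i z') - (\<Sum>i\<in>UNIV. f i u)) \<le>
      2 * \<alpha> k / n * (G \<bullet> (z - u) + n * ((B + M) * Y + M * (\<alpha> k * B)))"
    using n \<alpha>_nonneg[of k] by (intro mult_left_mono) auto
  also have "\<dots> = 2 * ((\<alpha> k / n) *\<^sub>R G \<bullet> (z - u)) + 2 * (B + M) * (\<alpha> k * Y) + 2 * M * B * (\<alpha> k)\<^sup>2"
    using n by (simp add: field_simps power2_eq_square)
  also have "2 * ((\<alpha> k / n) *\<^sub>R G \<bullet> (z - u)) =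
      (norm (z - u))\<^sup>2 - (norm (z' - u))\<^sup>2 + (norm ((\<alpha> k / n) *\<^sub>R G))\<^sup>2"
    unfolding z' power2_norm_eq_inner
    by (simp add: inner_diff_left inner_diff_right inner_commute algebra_simps)
  also have "(norm ((\<alpha> k / n) *\<^sub>R G))\<^sup>2 \<le> (\<alpha> k * B)\<^sup>2"
    using move by (intro power_mono) auto
  finally show ?thesis
    by (simp add: n_def z_def z'_def Y_def algebra_simps power_mult_distrib)
qed

text \<open>
  Summed over \<open>k\<close>, the squared distances telescope and the disagreement terms are absorbed by
  the sum of the squared step sizes. The gradients at the means inherit a bound from those at the
  rows, because the disagreement is bounded and the gradients are Lipschitz.
\<close>

lemma weighted_suboptimality:
  obtains C D where "0 \<le> C" "0 \<le> D"
    "\<And>K. (\<Sum>k\<le>K. \<alpha> k * (fbar f (xbar (x (Suc k))) - (\<Sum>i\<in>UNIV. f i u)))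
      \<le> C + D * (\<Sum>k\<le>K. (\<alpha> k)\<^sup>2)"
proof -
  obtain C D Y where CD: "0 \<le> C" "0 \<le> D" and Y: "\<And>k. norm (disagreement (x k)) \<le> Y"
    and sum_Y: "\<And>K. (\<Sum>k\<le>K. \<alpha> k * norm (disagreement (x k))) \<le> C + D * (\<Sum>k\<le>K. (\<alpha> k)\<^sup>2)"
    using consensus by blast
  define n where "n = real CARD('n)"
  define M where "M = B + L * Y"
  define d where "d k = (norm (row_mean (x k) - u))\<^sup>2" for k
  have n: "n > 0" by (simp add: n_def)
  have M: "norm (gradient (f i) (row_mean (x k))) \<le> M" for i k
  proof -
    have "dist (gradient (f i) (row_mean (x k))) (gradient (f i) (x k $ i))
        \<le> L * dist (row_mean (x k)) (x k $ i)"
      using lipschitz by (rule lipschitz_onD) auto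
    also have "\<dots> \<le> L * Y"
      using Y[of k] Finite_Cartesian_Product.norm_nth_le[of "disagreement (x k)" i] lipschitz_on_nonneg[OF lipschitz]
      by (intro mult_left_mono) (auto simp: disagreement_nth dist_norm norm_minus_commute)
    finally show ?thesis
      using norm_gradient_le[of i k]
        norm_triangle_sub[of "gradient (f i) (row_mean (x k))" "gradient (f i) (x k $ i)"]
      by (simp add: M_def dist_norm)
  qed
  have "0 \<le> M" using M norm_ge_zero order_trans by blast
  define E where "E = 2 * (B + M)"
  define H where "H = B\<^sup>2 + 2 * M * B"
  have EH: "0 \<le> E" "0 \<le> H" using B_nonneg \<open>0 \<le> M\<close> by (auto simp: E_def H_def)
  let ?r = "\<lambda>k. fbar f (xbar (x (Suc k))) - (\<Sum>i\<in>UNIV. f i u)"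
  have "(\<Sum>k\<le>K. \<alpha> k * ?r k) \<le> n / 2 * (d 0 + E * C) + n / 2 * (E * D + H) * (\<Sum>k\<le>K. (\<alpha> k)\<^sup>2)" for K
  proof -
    have "(\<Sum>k\<le>K. 2 * \<alpha> k / n * ?r k)
        \<le> (\<Sum>k\<le>K. d k - d (Suc k) + E * (\<alpha> k * norm (disagreement (x k))) + H * (\<alpha> k)\<^sup>2)"
      unfolding E_def H_def d_def n_def fbar_def xbar_nth by (intro sum_mono progress M)
    also have "\<dots> = d 0 - d (Suc K) + E * (\<Sum>k\<le>K. \<alpha> k * norm (disagreement (x k)))
        + H * (\<Sum>k\<le>K. (\<alpha> k)\<^sup>2)"
      by (simp add: sum.distrib sum_telescope sum_distrib_left)
    also have "\<dots> \<le> d 0 + E * (C + D * (\<Sum>k\<le>K. (\<alpha> k)\<^sup>2)) + H * (\<Sum>k\<le>K. (\<alpha> k)\<^sup>2)"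
      using mult_left_mono[OF sum_Y[of K] EH(1)] zero_le_power2[of "norm (row_mean (x (Suc K)) - u)"]
      unfolding d_def by linarith
    finally have "n / 2 * (\<Sum>k\<le>K. 2 * \<alpha> k / n * ?r k)
        \<le> n / 2 * (d 0 + E * (C + D * (\<Sum>k\<le>K. (\<alpha> k)\<^sup>2)) + H * (\<Sum>k\<le>K. (\<alpha> k)\<^sup>2))"
      using n by (intro mult_left_mono) auto
    moreover have "n / 2 * (\<Sum>k\<le>K. 2 * \<alpha> k / n * ?r k) = (\<Sum>k\<le>K. \<alpha> k * ?r k)"
      unfolding sum_distrib_left using n by (intro sum.cong) auto
    ultimately have "(\<Sum>k\<le>K. \<alpha> k * ?r k)
        \<le> n / 2 * (d 0 + E * (C + D * (\<Sum>k\<le>K. (\<alpha> k)\<^sup>2)) + H * (\<Sum>k\<le>K. (\<alpha> k)\<^sup>2))"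
      by simp
    also have "\<dots> = n / 2 * (d 0 + E * C) + n / 2 * (E * D + H) * (\<Sum>k\<le>K. (\<alpha> k)\<^sup>2)"
      by (simp add: algebra_simps add_divide_distrib)
    finally show ?thesis .
  qed
  moreover have "0 \<le> n / 2 * (d 0 + E * C)" "0 \<le> n / 2 * (E * D + H)"
    using n EH CD by (auto simp: d_def)
  ultimately show ?thesis using that by blast
qed

end

section \<open>Sums of powers and the resulting rates\<close>

text \<open>Every summand is at least the last one.\<close>

lemma sum_powr_ge:
  assumes "0 \<le> a"
  shows "(real K + 1) powr (1 - a) \<le> (\<Sum>k\<le>K. (real k + 1) powr - a)"
proof -
  have "(real K + 1) powr (1 - a) = (\<Sum>k\<le>K. (real K + 1) powr - a)"
    by (simp add: powr_add powr_diff powr_minus field_simps)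
  also have "\<dots> \<le> (\<Sum>k\<le>K. (real k + 1) powr - a)"
    using assms by (intro sum_mono powr_mono2') auto
  finally show ?thesis .
qed

text \<open>
  By the mean value theorem the summand \<open>(k + 1) powr - a\<close> is below a difference of values of the
  antiderivative \<open>t powr (1 - a) / (1 - a)\<close>, which then telescopes in \<open>sum_powr_le\<close>.
\<close>

lemma powr_Suc_diff_ge:
  assumes "0 \<le> a" "a < 1"
  shows "(1 - a) * (real k + 1) powr - a \<le> (real k + 1) powr (1 - a) - real k powr (1 - a)"
proof (cases "k = 0")
  case False
  have "\<exists>z>real k. z < real k + 1 \<and> (real k + 1) powr (1 - a) - real k powr (1 - a) =
      (real k + 1 - real k) * ((1 - a) * z powr (1 - a - 1))"
    using False by (intro MVT2) (auto intro!: DERIV_fun_powr derivative_eq_intros)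
  then obtain z where z: "real k < z" "z < real k + 1"
    "(real k + 1) powr (1 - a) - real k powr (1 - a) = (1 - a) * z powr - a"
    by auto
  have "(real k + 1) powr - a \<le> z powr - a"
    using assms z False by (intro powr_mono2') auto
  then show ?thesis using assms unfolding z(3) by (intro mult_left_mono) auto
qed (use assms in simp)

lemma sum_powr_le:
  assumes "0 \<le> a" "a < 1"
  shows "(\<Sum>k\<le>K. (real k + 1) powr - a) \<le> (real K + 1) powr (1 - a) / (1 - a)"
proof -
  have "(\<Sum>k\<le>K. (1 - a) * (real k + 1) powr - a)
      \<le> (\<Sum>k\<le>K. real (Suc k) powr (1 - a) - real k powr (1 - a))"
    using powr_Suc_diff_ge[OF assms] by (intro sum_mono) (simp add: add.commute)
  also have "\<dots> = (real K + 1) powr (1 - a)"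
    using sum_lessThan_telescope[of "\<lambda>k. real k powr (1 - a)" "Suc K"] assms
    by (simp add: lessThan_Suc_atMost add.commute)
  finally show ?thesis
    using assms by (simp add: sum_distrib_left[symmetric] pos_le_divide_eq mult.commute)
qed

lemma sum_powr_bounded:
  assumes "1 < a"
  obtains C where "\<And>K. (\<Sum>k\<le>K. (real k + 1) powr - a) \<le> C"
proof -
  have "summable (\<lambda>k. real (Suc k) powr - a)"
    using assms summable_Suc_iff[of "\<lambda>k. real k powr - a"] by (simp only: summable_real_powr_iff)
  then have "summable (\<lambda>k. (real k + 1) powr - a)" by (simp add: add.commute)
  then have "(\<Sum>k\<le>K. (real k + 1) powr - a) \<le> (\<Sum>k. (real k + 1) powr - a)" for K
    by (rule sum_le_suminf) auto
  then show ?thesis using that by blast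
qed

lemma sum_powr_minus_1: "(\<Sum>k\<le>K. (real k + 1) powr - 1) = harm (Suc K)"
proof -
  have "harm (Suc K) = (\<Sum>k\<le>K. inverse (real (Suc k)))"
    unfolding harm_def by (simp only: One_nat_def sum.atLeast1_atMost_eq lessThan_Suc_atMost)
  then show ?thesis by (simp add: powr_minus add.commute)
qed

lemma sum_powr_minus_1_ge: "ln (real K + 1) \<le> (\<Sum>k\<le>K. (real k + 1) powr - 1)"
  unfolding sum_powr_minus_1
  using ln_le_harm[of "Suc K"] ln_mono[of "real K + 1" "real (Suc K) + 1"] by linarith

lemma sum_powr_minus_1_le: "(\<Sum>k\<le>K. (real k + 1) powr - 1) \<le> 1 + ln (real K + 1)"
proof -
  have "harm (Suc K) - ln (real (Suc K)) \<le> harm (Suc 0) - ln (real (Suc 0))"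
    using decseqD[OF decseq_harm_diff_ln, of 0 K] by simp
  then show ?thesis unfolding sum_powr_minus_1 by (simp add: harm_def add.commute)
qed

text \<open>
  The denominator grows like \<open>K powr (1 - \<epsilon>)\<close> (like \<open>ln K\<close> if \<open>\<epsilon> = 1\<close>). The sum in the numerator
  diverges like \<open>K powr (1 - 2 * \<epsilon>)\<close> for \<open>\<epsilon> < 1/2\<close>, is a harmonic number for \<open>\<epsilon> = 1/2\<close>, and
  converges for \<open>\<epsilon> > 1/2\<close>; this is where the four cases come from.
\<close>

lemma averaging_rates:
  fixes r :: "nat \<Rightarrow> real"
  assumes \<epsilon>: "0 < \<epsilon>" "\<epsilon> \<le> 1" and CD: "0 \<le> C" "0 \<le> D"
    and r: "\<And>K. 0 \<le> r K" "\<And>K. r K \<le> (C + D * (\<Sum>k\<le>K. (real k + 1) powr - (2 * \<epsilon>)))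
      / (\<Sum>k\<le>K. (real k + 1) powr - \<epsilon>)"
  shows "\<epsilon> < 1/2 \<Longrightarrow> r \<in> O(\<lambda>K. 1 / real K powr \<epsilon>)"
    and "\<epsilon> = 1/2 \<Longrightarrow> r \<in> O(\<lambda>K. ln (real K) / sqrt (real K))"
    and "1/2 < \<epsilon> \<Longrightarrow> \<epsilon> < 1 \<Longrightarrow> r \<in> O(\<lambda>K. 1 / real K powr (1 - \<epsilon>))"
    and "\<epsilon> = 1 \<Longrightarrow> r \<in> O(\<lambda>K. 1 / ln (real K))"
    and "r \<longlonglongrightarrow> 0"
proof -
  let ?S = "\<lambda>a K. \<Sum>k\<le>K. (real k + 1) powr - a"
  have r_bigo: "r \<in> O(g)"
    if num: "\<And>K. ?S (2 * \<epsilon>) K \<le> p K" and den: "\<And>K. q K \<le> ?S \<epsilon> K"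
      and q: "eventually (\<lambda>K. 0 < q K) at_top"
      and g: "(\<lambda>K. (C + D * p K) / q K) \<in> O(g)" for p q g :: "nat \<Rightarrow> real"
  proof -
    have "eventually (\<lambda>K. norm (r K) \<le> norm ((C + D * p K) / q K)) at_top"
      using q
    proof eventually_elim
      case (elim K)
      have p: "0 \<le> p K" using num[of K] by (meson order_trans sum_nonneg powr_ge_zero)
      have "r K \<le> (C + D * ?S (2 * \<epsilon>) K) / ?S \<epsilon> K" by (rule r(2))
      also have "\<dots> \<le> (C + D * p K) / q K"
        using num den elim CD p by (intro frac_le add_left_mono mult_left_mono) auto
      finally show ?case using r(1)[of K] unfolding real_norm_def by linarith
    qed
    then have "r \<in> O(\<lambda>K. (C + D * p K) / q K)" by (rule landau_o.big_mono)
    with g show ?thesis using landau_o.big_trans by blast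
  qed
  have pos: "eventually (\<lambda>K. 0 < (real K + 1) powr (1 - \<epsilon>)) at_top" by simp
  show rate_a: "r \<in> O(\<lambda>K. 1 / real K powr \<epsilon>)" if "\<epsilon> < 1/2"
  proof (rule r_bigo[OF sum_powr_le sum_powr_ge pos])
    show "(\<lambda>K. (C + D * ((real K + 1) powr (1 - 2 * \<epsilon>) / (1 - 2 * \<epsilon>))) / (real K + 1) powr (1 - \<epsilon>))
        \<in> O(\<lambda>K. 1 / real K powr \<epsilon>)"
      using \<epsilon> that by real_asymp
  qed (use \<epsilon> that in auto)
  show rate_c: "r \<in> O(\<lambda>K. 1 / real K powr (1 - \<epsilon>))" if \<epsilon>': "1/2 < \<epsilon>" "\<epsilon> < 1"
  proof -
    obtain c where c: "\<And>K. ?S (2 * \<epsilon>) K \<le> c"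
      by (rule sum_powr_bounded[of "2 * \<epsilon>"]) (use \<epsilon>' in auto)
    show ?thesis
    proof (rule r_bigo[OF c sum_powr_ge pos])
      show "(\<lambda>K. (C + D * c) / (real K + 1) powr (1 - \<epsilon>)) \<in> O(\<lambda>K. 1 / real K powr (1 - \<epsilon>))"
        using \<epsilon>' by real_asymp
    qed (use \<epsilon> in auto)
  qed
  show rate_b: "r \<in> O(\<lambda>K. ln (real K) / sqrt (real K))" if "\<epsilon> = 1/2"
  proof (rule r_bigo)
    show "?S (2 * \<epsilon>) K \<le> 1 + ln (real K + 1)" for K
    proof -
      have "2 * \<epsilon> = 1" using that by simp
      then show ?thesis by (simp only: sum_powr_minus_1_le)
    qed
    show "(real K + 1) powr (1 - \<epsilon>) \<le> ?S \<epsilon> K" for K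
      using \<epsilon> by (intro sum_powr_ge) auto
    show "(\<lambda>K. (C + D * (1 + ln (real K + 1))) / (real K + 1) powr (1 - \<epsilon>))
        \<in> O(\<lambda>K. ln (real K) / sqrt (real K))"
      unfolding that by real_asymp
  qed (rule pos)
  show rate_d: "r \<in> O(\<lambda>K. 1 / ln (real K))" if \<epsilon>': "\<epsilon> = 1"
  proof -
    obtain c where c: "\<And>K. ?S (2 * \<epsilon>) K \<le> c"
      by (rule sum_powr_bounded[of "2 * \<epsilon>"]) (use \<epsilon>' in auto)
    show ?thesis
    proof (rule r_bigo[OF c])
      show "ln (real K + 1) \<le> ?S \<epsilon> K" for K using sum_powr_minus_1_ge that by simp
      show "eventually (\<lambda>K. 0 < ln (real K + 1)) at_top" by real_asymp
      show "(\<lambda>K. (C + D * c) / ln (real K + 1)) \<in> O(\<lambda>K. 1 / ln (real K))" by real_asymp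
    qed
  qed
  have lim: "r \<longlonglongrightarrow> 0" if "r \<in> O(g)" "g \<longlonglongrightarrow> 0" for g
    using landau_o.big_small_trans[OF that(1) smalloI_tendsto[of g "\<lambda>_. 1"]] that(2)
    by (auto dest: smalloD_tendsto)
  consider "\<epsilon> < 1/2" | "\<epsilon> = 1/2" | "1/2 < \<epsilon>" "\<epsilon> < 1" | "\<epsilon> = 1" using \<epsilon> by linarith
  then show "r \<longlonglongrightarrow> 0"
  proof cases
    case 1
    show ?thesis by (rule lim[OF rate_a[OF 1]]) (use \<epsilon> in real_asymp)
  next
    case 2
    show ?thesis by (rule lim[OF rate_b[OF 2]]) real_asymp
  next
    case 3
    show ?thesis by (rule lim[OF rate_c[OF 3]]) (use 3 in real_asymp)
  next
    case 4
    show ?thesis by (rule lim[OF rate_d[OF 4]]) real_asymp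
  qed
qed

section \<open>Convergence of the weighted averages\<close>

theorem proposition4:
  fixes E :: "('n::finite \<times> 'n) set"
    and W :: "real^'n^'n"
    and f :: "'n \<Rightarrow> real^'p \<Rightarrow> real"
    and L :: "'n \<Rightarrow> real" and L\<^sub>f \<epsilon> B f_opt :: real
    and \<alpha> :: "nat \<Rightarrow> real"
    and x :: "nat \<Rightarrow> real^'p^'n"
    and F :: "nat \<Rightarrow> real"
  assumes graph: "connected_undirected_graph E"
    and convex: "\<And>i. convex_on UNIV (f i)"
    and coercive: "\<And>i. filterlim (f i) at_top at_infinity"
    and differentiable: "\<And>i u. f i differentiable (at u)"
    and L_pos: "\<And>i. L i > 0"
    and lipschitz: "\<And>i. (L i)-lipschitz_on UNIV (gradient (f i))"
    and L\<^sub>f: "L\<^sub>f = Max (range L)"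
    and mixing: "mixing_matrix E W"
    and lambda_n_pos: "lambda_min W > 0"
    and \<epsilon>: "0 < \<epsilon>" "\<epsilon> \<le> 1"
    and \<alpha>: "\<And>k. \<alpha> k = 1 / (L\<^sub>f * (real k + 1) powr \<epsilon>)"
    and iteration: "\<And>k. x (Suc k) = W ** x k - \<alpha> k *\<^sub>R stacked_gradient f (x k)"
    and B_pos: "B > 0"
    and gradient_bounded: "\<And>k. norm (stacked_gradient f (x k)) \<le> B"
    and f_opt: "f_opt = min_value (\<lambda>u. \<Sum>i\<in>UNIV. f i u)"
    and F: "\<And>K. F K = (\<Sum>k=0..K. \<alpha> k * fbar f (xbar (x (Suc k)))) / (\<Sum>k=0..K. \<alpha> k)"
  shows "F \<longlonglongrightarrow> f_opt \<and>
    (\<epsilon> < 1/2 \<longrightarrow> (\<lambda>K. F K - f_opt) \<in> O(\<lambda>K. 1 / real K powr \<epsilon>)) \<and>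
    (\<epsilon> = 1/2 \<longrightarrow> (\<lambda>K. F K - f_opt) \<in> O(\<lambda>K. ln (real K) / sqrt (real K))) \<and>
    (1/2 < \<epsilon> \<and> \<epsilon> < 1 \<longrightarrow> (\<lambda>K. F K - f_opt) \<in> O(\<lambda>K. 1 / real K powr (1 - \<epsilon>))) \<and>
    (\<epsilon> = 1 \<longrightarrow> (\<lambda>K. F K - f_opt) \<in> O(\<lambda>K. 1 / ln (real K)))"
proof -
  have "L i \<le> L\<^sub>f" for i unfolding L\<^sub>f by (intro Max_ge) auto
  with L_pos have L\<^sub>f_pos: "0 < L\<^sub>f" by (meson less_le_trans)
  have \<alpha>_powr: "\<alpha> k = (real k + 1) powr - \<epsilon> / L\<^sub>f" for k
    by (simp add: \<alpha> powr_minus divide_inverse)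
  have \<alpha>_pos: "0 < \<alpha> k" for k using L\<^sub>f_pos by (simp add: \<alpha>_powr)
  have "decseq \<alpha>"
    unfolding decseq_def \<alpha>_powr using \<epsilon> L\<^sub>f_pos
    by (intro allI impI divide_right_mono powr_mono2') auto
  have "averaging_matrix W"
  proof
    show "transpose W = W" using mixing by (simp add: mixing_matrix_def)
    show "v \<bullet> (W *v v) \<le> v \<bullet> v" for v
    proof -
      have "0 \<le> v \<bullet> ((mat 1 - W) *v v)"
        using mixing by (simp add: mixing_matrix_def pos_semidef_def)
      then show ?thesis by (simp add: matrix_vector_mult_diff_rdistrib inner_diff_right)
    qed
    show "- (v \<bullet> v) < v \<bullet> (W *v v)" if "v \<noteq> 0" for v
    proof -
      have "0 < v \<bullet> ((W - (- mat 1)) *v v)"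
        using mixing that unfolding mixing_matrix_def pos_def_def by blast
      then show ?thesis by (simp add: matrix_vector_mult_add_rdistrib inner_add_right)
    qed
    show "W *v v = v \<longleftrightarrow> v \<in> span {1}" for v
    proof -
      have "v \<in> span {1} \<longleftrightarrow> (mat 1 - W) *v v = 0"
        using mixing unfolding mixing_matrix_def by blast
      then show ?thesis by (auto simp: matrix_vector_mult_diff_rdistrib)
    qed
  qed
  then interpret averaging_matrix W .
  interpret decentralized_gradient_descent W f L\<^sub>f B \<alpha> x
  proof
    show "L\<^sub>f-lipschitz_on UNIV (gradient (f i))" for i
      by (rule lipschitz_on_mono[OF lipschitz[of i] _ \<open>L i \<le> L\<^sub>f\<close>]) simp
  qed (use convex differentiable \<alpha>_pos \<open>decseq \<alpha>\<close> iteration gradient_bounded in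
      \<open>auto intro: less_imp_le\<close>)
  let ?h = "\<lambda>u. \<Sum>i\<in>UNIV. f i u"
  have "continuous_on UNIV ?h"
    using differentiable differentiable_imp_continuous_within
    by (intro continuous_on_sum continuous_at_imp_continuous_on) blast
  moreover have "filterlim ?h at_top at_infinity"
    using coercive by (intro coercive_sum) auto
  ultimately have "\<exists>u. \<forall>v. ?h u \<le> ?h v" by (rule coercive_attains_min)
  then obtain u where u: "?h u = f_opt" "\<And>v. f_opt \<le> ?h v"
    unfolding f_opt by (rule min_value_attained) blast
  obtain C D where CD: "0 \<le> C" "0 \<le> D"
    "\<And>K. (\<Sum>k\<le>K. \<alpha> k * (fbar f (xbar (x (Suc k))) - f_opt)) \<le> C + D * (\<Sum>k\<le>K. (\<alpha> k)\<^sup>2)"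
    using weighted_suboptimality[of u] unfolding u(1) by blast
  have sum_pos: "0 < (\<Sum>k\<le>K. \<alpha> k)" for K
    by (intro sum_pos \<alpha>_pos) auto
  have F_diff: "F K - f_opt =
      (\<Sum>k\<le>K. \<alpha> k * (fbar f (xbar (x (Suc k))) - f_opt)) / (\<Sum>k\<le>K. \<alpha> k)" for K
    using sum_pos[of K]
    by (simp add: F atLeast0AtMost right_diff_distrib sum_subtractf sum_distrib_right[symmetric]
        diff_divide_distrib)
  have nonneg: "0 \<le> F K - f_opt" for K
    unfolding F_diff using u(2) sum_pos[of K] \<alpha>_pos
    by (intro divide_nonneg_pos sum_nonneg mult_nonneg_nonneg)
      (auto simp: fbar_def xbar_nth less_imp_le)
  have upper: "F K - f_opt \<le> (C * L\<^sub>f + D / L\<^sub>f * (\<Sum>k\<le>K. (real k + 1) powr - (2 * \<epsilon>)))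
      / (\<Sum>k\<le>K. (real k + 1) powr - \<epsilon>)" for K
  proof -
    have "(\<alpha> k)\<^sup>2 = (real k + 1) powr - (2 * \<epsilon>) / L\<^sub>f\<^sup>2" for k
      by (simp add: \<alpha>_powr power_divide power2_eq_square powr_add[symmetric])
    then have sq: "(\<Sum>k\<le>K. (\<alpha> k)\<^sup>2) = (\<Sum>k\<le>K. (real k + 1) powr - (2 * \<epsilon>)) / L\<^sub>f\<^sup>2"
      by (simp add: sum_divide_distrib)
    have sm: "(\<Sum>k\<le>K. \<alpha> k) = (\<Sum>k\<le>K. (real k + 1) powr - \<epsilon>) / L\<^sub>f"
      by (simp add: \<alpha>_powr sum_divide_distrib)
    have "F K - f_opt \<le> (C + D * (\<Sum>k\<le>K. (\<alpha> k)\<^sup>2)) / (\<Sum>k\<le>K. \<alpha> k)"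
      unfolding F_diff using CD(3)[of K] sum_pos[of K] by (intro divide_right_mono) auto
    also have "\<dots> = (C * L\<^sub>f + D / L\<^sub>f * (\<Sum>k\<le>K. (real k + 1) powr - (2 * \<epsilon>)))
        / (\<Sum>k\<le>K. (real k + 1) powr - \<epsilon>)"
      unfolding sq sm using L\<^sub>f_pos by (simp add: power2_eq_square distrib_right)
    finally show ?thesis .
  qed
  have "0 \<le> C * L\<^sub>f" "0 \<le> D / L\<^sub>f" using CD L\<^sub>f_pos by auto
  note rates = averaging_rates[OF \<epsilon> this nonneg upper]
  show ?thesis
    using rates(1-4) rates(5) by (auto simp: LIM_zero_iff)
qed

end
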